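(* Let $(U,\Sigma,\mu)$ be a $\sigma$-finite measure space with a full ordered core $\mathcal A$. Every $g\in L(\Sigma)$ has a least core decreasing majorant $\widetilde g$, which is unique up to equality $\mu$-a.e. If $g_n\in L^+(\Sigma)$ and $g_n\uparrow g$ $\mu$-a.e., then $\widetilde{g_n}\uparrow\widetilde g$ $\mu$-a.e.
   Context: $L(\Sigma)$ is the set of $\Sigma$-measurable functions $U\to[-\infty,\infty]$ and $L^+(\Sigma)$ the set of nonnegative ones. An ordered core of $(U,\Sigma,\mu)$ is a subset $\mathcal A\subseteq\Sigma$, totally ordered by inclusion, containing $\emptyset$, whose members all have finite $\mu$-measure. It is $\sigma$-bounded if $\bigcup\mathcal A=\bigcup\mathcal A_0$ for some countable $\mathcal A_0\subseteq\mathcal A$, and full if it is $\sigma$-bounded and $\bigcup\mathcal A=U$. $\sigma(\mathcal A)$ is the $\sigma$-ring generated by $\mathcal A$ (a $\sigma$-algebra on $U$ when $\mathcal A$ is full). Write $u\le_{\mathcal A}v$ if for all $A\in\mathcal A$, $v\in A$ implies $u\in A$. $L^\downarrow(\mathcal A)$ is the set of core decreasing functions: $\sigma(\mathcal A)$-measurable $f:U\to[0,\infty]$ with $f(u)\ge f(v)$ whenever $u\le_{\mathcal A}v$. For $g\in L(\Sigma)$, $h$ is a core decreasing majorant of $g$ if $h\in L^\downarrow(\mathcal A)$ and $|g|\le h$ $\mu$-a.e. A least core decreasing majorant of $g$ is a core decreasing majorant $\widetilde g$ of $g$ such that $\widetilde g\le h$ $\mu$-a.e. for every core decreasing majorant $h$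 of $g$. *)

theory Defs
  imports "HOL-Analysis.Analysis"
begin

definition ordered_core :: "'a measure \<Rightarrow> 'a set set \<Rightarrow> bool" where
  "ordered_core M \<A> \<longleftrightarrow>
     \<A> \<subseteq> sets M \<and>
     (\<forall>A\<in>\<A>. \<forall>B\<in>\<A>. A \<subseteq> B \<or> B \<subseteq> A) \<and>
     {} \<in> \<A> \<and>
     (\<forall>A\<in>\<A>. emeasure M A < \<infinity>)"

definition sigma_bounded :: "'a set set \<Rightarrow> bool" where
  "sigma_bounded \<A> \<longleftrightarrow> (\<exists>\<A>\<^sub>0\<subseteq>\<A>. countable \<A>\<^sub>0 \<and> \<Union>\<A> = \<Union>\<A>\<^sub>0)"

definition full_ordered_core :: "'a measure \<Rightarrow> 'a set set \<Rightarrow> bool" where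
  "full_ordered_core M \<A> \<longleftrightarrow>
     ordered_core M \<A> \<and> sigma_bounded \<A> \<and> \<Union>\<A> = space M"

inductive_set sigma_ring_sets :: "'a set set \<Rightarrow> 'a set set" for \<A> :: "'a set set" where
  Basic: "A \<in> \<A> \<Longrightarrow> A \<in> sigma_ring_sets \<A>"
| Empty: "{} \<in> sigma_ring_sets \<A>"
| Diff: "A \<in> sigma_ring_sets \<A> \<Longrightarrow> B \<in> sigma_ring_sets \<A> \<Longrightarrow> A - B \<in> sigma_ring_sets \<A>"
| Union: "(\<And>i::nat. F i \<in> sigma_ring_sets \<A>) \<Longrightarrow> (\<Union>i. F i) \<in> sigma_ring_sets \<A>"

definition core_le :: "'a set set \<Rightarrow> 'a \<Rightarrow> 'a \<Rightarrow> bool" where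
  "core_le \<A> u v \<longleftrightarrow> (\<forall>A\<in>\<A>. v \<in> A \<longrightarrow> u \<in> A)"

text \<open>
  All functions are extended-real valued and only their values on \<^term>\<open>space M\<close> matter;
  \<^term>\<open>borel_measurable M :: ('a \<Rightarrow> ereal) set\<close> is the set of measurable functions
  with values in the extended reals.
\<close>

definition nonneg_measurable :: "'a measure \<Rightarrow> ('a \<Rightarrow> ereal) set" where
  "nonneg_measurable M = {g \<in> borel_measurable M. \<forall>u\<in>space M. 0 \<le> g u}"

text \<open>
  Measurability is with respect to \<^term>\<open>sigma (space M) (sigma_ring_sets \<A>)\<close>. For a full core
  the generated sigma-ring already is a sigma-algebra on \<^term>\<open>space M\<close>, so passing to
  \<^const>\<open>sigma\<close> adds no sets (see \<open>sets_sigma_sigma_ring\<close> below).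
\<close>

definition core_decreasing :: "'a measure \<Rightarrow> 'a set set \<Rightarrow> ('a \<Rightarrow> ereal) set" where
  "core_decreasing M \<A> =
     {f \<in> borel_measurable (sigma (space M) (sigma_ring_sets \<A>)).
        (\<forall>u\<in>space M. 0 \<le> f u) \<and>
        (\<forall>u\<in>space M. \<forall>v\<in>space M. core_le \<A> u v \<longrightarrow> f v \<le> f u)}"

definition core_dec_majorant ::
  "'a measure \<Rightarrow> 'a set set \<Rightarrow> ('a \<Rightarrow> ereal) \<Rightarrow> ('a \<Rightarrow> ereal) \<Rightarrow> bool" where
  "core_dec_majorant M \<A> g h \<longleftrightarrow>
     h \<in> core_decreasing M \<A> \<and> (AE x in M. \<bar>g x\<bar> \<le> h x)"

definition least_core_dec_majorant ::
  "'a measure \<Rightarrow> 'a set set \<Rightarrow> ('a \<Rightarrow> ereal) \<Rightarrow> ('a \<Rightarrow> ereal) \<Rightarrow> bool" where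
  "least_core_dec_majorant M \<A> g k \<longleftrightarrow>
     core_dec_majorant M \<A> g k \<and>
     (\<forall>h. core_dec_majorant M \<A> g h \<longrightarrow> (AE x in M. k x \<le> h x))"

definition AE_increases_to ::
  "'a measure \<Rightarrow> (nat \<Rightarrow> 'a \<Rightarrow> ereal) \<Rightarrow> ('a \<Rightarrow> ereal) \<Rightarrow> bool" where
  "AE_increases_to M f g \<longleftrightarrow>
     (AE x in M. incseq (\<lambda>n. f n x) \<and> (\<lambda>n. f n x) \<longlonglongrightarrow> g x)"

lemma sigma_ring_sets_eq_sigma_sets:
  assumes "full_ordered_core M \<A>"
  shows "sigma_ring_sets \<A> = sigma_sets (space M) \<A>"
proof -
  have sub: "\<A> \<subseteq> Pow (space M)"
    using assms by (auto simp: full_ordered_core_def)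
  obtain \<A>\<^sub>0 where A0: "\<A>\<^sub>0 \<subseteq> \<A>" "countable \<A>\<^sub>0" "space M = \<Union>\<A>\<^sub>0"
    using assms by (auto simp: full_ordered_core_def sigma_bounded_def)
  have "{} \<in> \<A>"
    using assms by (auto simp: full_ordered_core_def ordered_core_def)
  define F where "F = from_nat_into (insert {} \<A>\<^sub>0)"
  have "range F = insert {} \<A>\<^sub>0"
    unfolding F_def using A0(2) by (intro range_from_nat_into) auto
  then have F: "(\<Union>i. F i) = space M" "range F \<subseteq> \<A>"
    using A0 \<open>{} \<in> \<A>\<close> by auto
  have space_in_ring: "space M \<in> sigma_ring_sets \<A>"
    using sigma_ring_sets.Union[of F \<A>] F sigma_ring_sets.Basic[of _ \<A>]
    by (metis range_subsetD)
  interpret sigma_algebra "space M" "sigma_sets (space M) \<A>"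
    using sub by (rule sigma_algebra_sigma_sets)
  show ?thesis
  proof (intro equalityI subsetI)
    fix X assume "X \<in> sigma_ring_sets \<A>"
    then show "X \<in> sigma_sets (space M) \<A>"
      by induction (auto intro: sigma_sets.intros)
  next
    fix X assume "X \<in> sigma_sets (space M) \<A>"
    then show "X \<in> sigma_ring_sets \<A>"
      by induction
        (auto intro: sigma_ring_sets.Basic sigma_ring_sets.Empty sigma_ring_sets.Union
          sigma_ring_sets.Diff[OF space_in_ring])
  qed
qed

lemma sets_sigma_sigma_ring:
  assumes "full_ordered_core M \<A>"
  shows "sets (sigma (space M) (sigma_ring_sets \<A>)) = sigma_ring_sets \<A>"
proof -
  have sub: "\<A> \<subseteq> Pow (space M)"
    using assms by (auto simp: full_ordered_core_def)
  then have "sigma_sets (space M) \<A> \<subseteq> Pow (space M)"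
    using sigma_sets_into_sp by blast
  with sub show ?thesis
    by (simp add: sigma_ring_sets_eq_sigma_sets[OF assms] sigma_sets_sigma_sets_eq)
qed

end

theory Submission
  imports Defs
begin

text \<open>
  The core decreasing majorants of \<open>g\<close> form a nonempty family (the constant \<open>\<infinity>\<close> belongs to it)
  that is closed under countable pointwise infima: each of the countably many majorisations fails
  only on a null set, and both monotonicity along the core and measurability survive the infimum.
  Over a \<open>\<sigma>\<close>-finite measure such a family contains an a.e. smallest member, which is its essential
  infimum (\<open>exists_AE_least_of_INF_closed\<close>). The infimum of the uncountable family is thus reached by
  a countable one, and this member is the least core decreasing majorant. Uniqueness is antisymmetry
  of the a.e. order.

  For the monotone limit, least majorants depend monotonically on the majorised function, so the
  \<open>k\<^sub>n\<close> belonging to \<open>g\<^sub>n\<close> increase a.e. and lie below the \<open>k\<close> belonging to \<open>g\<close>. Conversely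
  \<open>sup\<^sub>n k\<^sub>n\<close> is core decreasing and dominates every \<open>g\<^sub>n\<close>, hence \<open>g\<close>, so minimality of \<open>k\<close> gives
  \<open>k \<le> sup\<^sub>n k\<^sub>n\<close>.
\<close>

lemma ennreal_inverse_le_iff: "inverse a \<le> inverse b \<longleftrightarrow> b \<le> (a :: ennreal)"
proof -
  have antimono: "inverse x \<le> inverse y" if "y \<le> x" for x y :: ennreal
    using that
    by (simp add: less_eq_ennreal.rep_eq inverse_ennreal.rep_eq ereal_inverse_antimono)
  have involutive: "inverse (inverse x) = x" for x :: ennreal
    by (cases x; cases "x = 0") (simp_all add: inverse_ennreal)
  show ?thesis
    using antimono[of b a] antimono[of "inverse a" "inverse b"] by (auto simp: involutive)
qed

text \<open>
  Weight the measure by a positive integrable \<open>w\<close> and compress the values by the bounded, strictly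
  decreasing function \<open>t \<mapsto> 1 / (1 + t)\<close>. The functional \<open>J h = \<integral> w / (1 + h)\<close> is then finite and
  strictly decreasing modulo null sets. The infimum of a maximising sequence is a maximiser \<open>k\<close> of \<open>J\<close>.
  If \<open>k \<le> h\<close> failed on a set of positive measure, replacing \<open>k\<close> by \<open>min h k\<close> would raise \<open>J\<close>.
\<close>
lemma exists_AE_least_of_INF_closed:
  fixes M :: "'a measure" and H :: "('a \<Rightarrow> ereal) set"
  assumes "sigma_finite_measure M"
    and meas: "H \<subseteq> borel_measurable M"
    and nonneg: "\<And>h x. h \<in> H \<Longrightarrow> x \<in> space M \<Longrightarrow> 0 \<le> h x"
    and "H \<noteq> {}"
    and closed: "\<And>F :: nat \<Rightarrow> 'a \<Rightarrow> ereal. range F \<subseteq> H \<Longrightarrow> (\<lambda>x. INF n. F n x) \<in> H"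
  shows "\<exists>k\<in>H. \<forall>h\<in>H. AE x in M. k x \<le> h x"
proof -
  interpret sigma_finite_measure M by fact
  obtain w :: "'a \<Rightarrow> ennreal" where w: "w \<in> borel_measurable M" "integral\<^sup>N M w \<noteq> \<infinity>"
    "\<And>x. x \<in> space M \<Longrightarrow> 0 < w x \<and> w x < \<infinity>"
    using Ex_finite_integrable_function by blast
  define \<phi> where "\<phi> t = inverse (1 + e2ennreal t)" for t :: ereal
  define J where "J h = (\<integral>\<^sup>+ x. w x * \<phi> (h x) \<partial>M)" for h
  have phi_antimono: "\<phi> t \<le> \<phi> s" if "s \<le> t" for s t
    using that by (simp add: \<phi>_def ennreal_inverse_le_iff add_left_mono e2ennreal_mono)
  have phi_le_1: "\<phi> t \<le> 1" for t
    using ennreal_inverse_le_iff[of "1 + e2ennreal t" 1] by (simp add: \<phi>_def)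
  have phi_reflects: "s \<le> t" if "\<phi> t \<le> \<phi> s" "0 \<le> s" "0 \<le> t" for s t
  proof -
    have "e2ennreal s \<le> e2ennreal t"
      using that(1) by (simp add: \<phi>_def ennreal_inverse_le_iff ennreal_add_left_cancel_le)
    then have "enn2ereal (e2ennreal s) \<le> enn2ereal (e2ennreal t)"
      by (simp add: less_eq_ennreal.rep_eq)
    then show ?thesis
      using that by (simp add: enn2ereal_e2ennreal)
  qed
  have phi_meas[measurable]: "\<phi> \<in> borel_measurable borel"
    unfolding \<phi>_def by measurable
  note w(1)[measurable]
  have J_finite: "J h < \<infinity>" for h
  proof -
    have "J h \<le> integral\<^sup>N M w"
      unfolding J_def using mult_left_mono[OF phi_le_1] by (intro nn_integral_mono) fastforce
    then show ?thesis using w(2) by (simp add: less_top order_le_less_trans)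
  qed
  have J_antimono: "J h \<le> J h'" if "\<And>x. h' x \<le> h x" for h h'
    unfolding J_def using that by (intro nn_integral_mono mult_left_mono phi_antimono) auto
  obtain s where s: "range s \<subseteq> J ` H" "(SUP h\<in>H. J h) = (SUP n::nat. s n)"
    using ennreal_SUP_countable_SUP[OF \<open>H \<noteq> {}\<close>, of J] by auto
  have "\<exists>h\<in>H. J h = s n" for n
    using s(1) by (metis imageE rangeI subsetD)
  then obtain F where F: "\<And>n. F n \<in> H" "\<And>n. J (F n) = s n"
    by metis
  define k where "k x = (INF n. F n x)" for x
  have k: "k \<in> H"
    unfolding k_def using F by (intro closed) auto
  have J_max: "J h \<le> J k" if "h \<in> H" for h
  proof -
    have "J h \<le> (SUP n. s n)"
      using that s(2) by (metis SUP_upper)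
    also have "\<dots> \<le> J k"
      by (intro SUP_least) (auto simp: F(2)[symmetric] k_def intro!: J_antimono INF_lower)
    finally show ?thesis .
  qed
  have "AE x in M. k x \<le> h x" if h: "h \<in> H" for h
  proof -
    \<comment> \<open>Prepending \<open>h\<close> to the sequence \<open>F\<close> exhibits \<open>min h k\<close> as a countable infimum, hence as a
      member of \<open>H\<close>.\<close>
    define m where "m x = min (h x) (k x)" for x
    have "m = (\<lambda>x. INF n. case_nat h F n x)"
    proof
      fix x
      show "m x = (INF n. case_nat h F n x)"
      proof (rule antisym)
        show "m x \<le> (INF n. case_nat h F n x)"
          by (rule INF_greatest)
            (auto simp: m_def k_def split: nat.split intro: min.coboundedI2 INF_lower)
        show "(INF n. case_nat h F n x) \<le> m x"
          unfolding m_def k_def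
          by (intro min.boundedI INF_greatest)
            (auto intro: INF_lower2[of 0] INF_lower2[of "Suc _"])
      qed
    qed
    moreover have "\<dots> \<in> H"
      using F(1) h by (intro closed) (auto split: nat.split)
    ultimately have m: "m \<in> H" by simp
    have [measurable]: "m \<in> borel_measurable M" "k \<in> borel_measurable M"
      using meas m k by auto
    have "AE x in M. w x * \<phi> (m x) \<le> w x * \<phi> (k x)"
    proof (rule ccontr)
      assume not_AE: "\<not> ?thesis"
      have "J k < J m"
        unfolding J_def
      proof (rule nn_integral_less[OF _ _ _ _ not_AE])
        show "(\<integral>\<^sup>+ x. w x * \<phi> (k x) \<partial>M) \<noteq> \<infinity>"
          using J_finite[of k] by (simp add: J_def)
        show "AE x in M. w x * \<phi> (k x) \<le> w x * \<phi> (m x)"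
          by (auto simp: m_def intro!: mult_left_mono phi_antimono)
      qed measurable
      with J_max[OF m] show False by simp
    qed
    with AE_space show ?thesis
    proof eventually_elim
      case (elim x)
      then have "\<phi> (m x) \<le> \<phi> (k x)"
        using w(3)[of x] ennreal_mult_le_mult_iff[of "w x"] by force
      then have "k x \<le> m x"
        using nonneg[OF k elim(1)] nonneg[OF m elim(1)] by (rule phi_reflects)
      then show ?case by (simp add: m_def)
    qed
  qed
  with k show ?thesis by blast
qed

text \<open>
  The core consists of \<open>M\<close>-measurable sets, so the \<open>\<sigma>\<close>-algebra that it generates is coarser than that
  of \<open>M\<close>. This is what allows core decreasing functions to be integrated against \<open>M\<close>.
\<close>
lemma core_decreasing_measurable:
  assumes "full_ordered_core M \<A>" "f \<in> core_decreasing M \<A>"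
  shows "f \<in> borel_measurable M"
proof -
  have "sigma_sets (space M) \<A> \<subseteq> sets M"
    using assms(1) sets.sigma_sets_subset
    by (auto simp: full_ordered_core_def ordered_core_def)
  then have "sets (sigma (space M) (sigma_ring_sets \<A>)) \<subseteq> sets M"
    using sets_sigma_sigma_ring[OF assms(1)] sigma_ring_sets_eq_sigma_sets[OF assms(1)] by simp
  then have "borel_measurable (sigma (space M) (sigma_ring_sets \<A>)) \<subseteq> borel_measurable M"
    by (intro measurable_mono) (auto simp: space_measure_of_conv)
  with assms(2) show ?thesis
    by (auto simp: core_decreasing_def)
qed

lemma core_decreasing_top: "(\<lambda>_. \<infinity>) \<in> core_decreasing M \<A>"
  by (simp add: core_decreasing_def)

lemma core_decreasing_INF:
  assumes "\<And>n::nat. F n \<in> core_decreasing M \<A>"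
  shows "(\<lambda>x. INF n. F n x) \<in> core_decreasing M \<A>"
proof -
  have [measurable]: "F n \<in> borel_measurable (sigma (space M) (sigma_ring_sets \<A>))" for n
    using assms[of n] by (simp add: core_decreasing_def)
  have "(\<lambda>x. INF n. F n x) \<in> borel_measurable (sigma (space M) (sigma_ring_sets \<A>))"
    by measurable
  then show ?thesis
    using assms unfolding core_decreasing_def
    by (auto intro!: INF_greatest INF_mono) blast
qed

lemma core_decreasing_SUP:
  assumes "\<And>n::nat. F n \<in> core_decreasing M \<A>"
  shows "(\<lambda>x. SUP n. F n x) \<in> core_decreasing M \<A>"
proof -
  have [measurable]: "F n \<in> borel_measurable (sigma (space M) (sigma_ring_sets \<A>))" for n
    using assms[of n] by (simp add: core_decreasing_def)
  have "(\<lambda>x. SUP n. F n x) \<in> borel_measurable (sigma (space M) (sigma_ring_sets \<A>))"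
    by measurable
  then show ?thesis
    using assms unfolding core_decreasing_def
    by (auto intro!: SUP_mono intro: SUP_upper2) blast
qed

lemma exists_least_core_dec_majorant:
  assumes "sigma_finite_measure M" "full_ordered_core M \<A>"
  shows "\<exists>k. least_core_dec_majorant M \<A> g k"
proof -
  let ?H = "{h. core_dec_majorant M \<A> g h}"
  have "\<exists>k\<in>?H. \<forall>h\<in>?H. AE x in M. k x \<le> h x"
  proof (rule exists_AE_least_of_INF_closed[OF assms(1)])
    show "?H \<subseteq> borel_measurable M"
      using core_decreasing_measurable[OF assms(2)] by (auto simp: core_dec_majorant_def)
    show "0 \<le> h x" if "h \<in> ?H" "x \<in> space M" for h x
      using that by (auto simp: core_dec_majorant_def core_decreasing_def)
    show "?H \<noteq> {}"
      using core_decreasing_top[of M \<A>]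
      by (auto simp: core_dec_majorant_def intro!: exI[of _ "\<lambda>_. \<infinity>"])
    show "(\<lambda>x. INF n. F n x) \<in> ?H" if "range F \<subseteq> ?H" for F :: "nat \<Rightarrow> 'a \<Rightarrow> ereal"
    proof -
      have F: "F n \<in> core_decreasing M \<A>" "AE x in M. \<bar>g x\<bar> \<le> F n x" for n
        using that by (auto simp: core_dec_majorant_def)
      have "AE x in M. \<forall>n. \<bar>g x\<bar> \<le> F n x"
        using F(2) by (simp add: AE_all_countable)
      then have "AE x in M. \<bar>g x\<bar> \<le> (INF n. F n x)"
        by eventually_elim (auto intro: INF_greatest)
      with core_decreasing_INF[of F, OF F(1)] show ?thesis
        by (simp add: core_dec_majorant_def)
    qed
  qed
  then show ?thesis
    by (auto simp: least_core_dec_majorant_def)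
qed

lemma least_core_dec_majorant_AE_mono:
  assumes "least_core_dec_majorant M \<A> f k" "least_core_dec_majorant M \<A> g l"
    and "AE x in M. \<bar>f x\<bar> \<le> \<bar>g x\<bar>"
  shows "AE x in M. k x \<le> l x"
proof -
  have "AE x in M. \<bar>g x\<bar> \<le> l x"
    using assms(2) by (simp add: least_core_dec_majorant_def core_dec_majorant_def)
  with assms(3) have "AE x in M. \<bar>f x\<bar> \<le> l x"
    by eventually_elim (rule order_trans)
  with assms(1,2) show ?thesis
    by (simp add: least_core_dec_majorant_def core_dec_majorant_def)
qed

lemma least_core_dec_majorant_AE_unique:
  assumes "least_core_dec_majorant M \<A> g k" "least_core_dec_majorant M \<A> g k'"
  shows "AE x in M. k x = k' x"
proof -
  have "AE x in M. k x \<le> k' x" "AE x in M. k' x \<le> k x"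
    using assms by (auto intro: least_core_dec_majorant_AE_mono)
  then show ?thesis
    by eventually_elim (rule antisym)
qed

lemma least_core_dec_majorant_AE_increases_to:
  assumes gs_nonneg: "\<And>n. AE x in M. 0 \<le> gs n x"
    and incr: "AE_increases_to M gs g"
    and ks: "\<And>n. least_core_dec_majorant M \<A> (gs n) (ks n)"
    and k: "least_core_dec_majorant M \<A> g k"
  shows "AE_increases_to M ks k"
proof -
  have "AE x in M. \<forall>n. 0 \<le> gs n x"
    using gs_nonneg by (simp add: AE_all_countable)
  moreover have "AE x in M. incseq (\<lambda>n. gs n x) \<and> (\<lambda>n. gs n x) \<longlonglongrightarrow> g x"
    using incr by (simp add: AE_increases_to_def)
  ultimately have pointwise: "AE x in M. g x = (SUP n. gs n x) \<and> 0 \<le> g x \<and>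
      (\<forall>n. 0 \<le> gs n x \<and> gs n x \<le> gs (Suc n) x \<and> gs n x \<le> g x)"
  proof eventually_elim
    case (elim x)
    then have "g x = (SUP n. gs n x)"
      using LIMSEQ_SUP LIMSEQ_unique by blast
    moreover have "gs n x \<le> (SUP n. gs n x)" for n
      by (rule SUP_upper) simp
    ultimately show ?case
      using elim by (auto simp: incseq_Suc_iff intro: order_trans)
  qed
  have "AE x in M. ks n x \<le> ks (Suc n) x" for n
  proof (rule least_core_dec_majorant_AE_mono[OF ks ks])
    show "AE x in M. \<bar>gs n x\<bar> \<le> \<bar>gs (Suc n) x\<bar>"
      using pointwise by eventually_elim simp
  qed
  then have ks_incr: "AE x in M. \<forall>n. ks n x \<le> ks (Suc n) x"
    by (simp add: AE_all_countable)
  have "AE x in M. ks n x \<le> k x" for n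
  proof (rule least_core_dec_majorant_AE_mono[OF ks k])
    show "AE x in M. \<bar>gs n x\<bar> \<le> \<bar>g x\<bar>"
      using pointwise by eventually_elim (metis abs_ereal_ge0)
  qed
  then have ks_le: "AE x in M. \<forall>n. ks n x \<le> k x"
    by (simp add: AE_all_countable)
  have "AE x in M. \<forall>n. \<bar>gs n x\<bar> \<le> ks n x"
    using ks by (simp add: AE_all_countable least_core_dec_majorant_def core_dec_majorant_def)
  with pointwise have "AE x in M. \<bar>g x\<bar> \<le> (SUP n. ks n x)"
  proof eventually_elim
    case (elim x)
    then have "gs n x \<le> ks n x" for n
      by (metis abs_ereal_ge0)
    then have "(SUP n. gs n x) \<le> (SUP n. ks n x)"
      by (intro SUP_mono) auto
    with elim show ?case by (metis abs_ereal_ge0)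
  qed
  moreover have "(\<lambda>x. SUP n. ks n x) \<in> core_decreasing M \<A>"
    using ks by (intro core_decreasing_SUP)
      (simp add: least_core_dec_majorant_def core_dec_majorant_def)
  ultimately have "AE x in M. k x \<le> (SUP n. ks n x)"
    using k by (simp add: least_core_dec_majorant_def core_dec_majorant_def)
  with ks_incr ks_le have "AE x in M. incseq (\<lambda>n. ks n x) \<and> (\<lambda>n. ks n x) \<longlonglongrightarrow> k x"
  proof eventually_elim
    case (elim x)
    then have inc: "incseq (\<lambda>n. ks n x)"
      by (simp add: incseq_Suc_iff)
    have "k x = (SUP n. ks n x)"
    proof (rule antisym)
      show "k x \<le> (SUP n. ks n x)" using elim by blast
      show "(SUP n. ks n x) \<le> k x" using elim by (intro SUP_least) blast
    qed
    with inc LIMSEQ_SUP[OF inc] show ?case by simp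
  qed
  then show ?thesis
    by (simp add: AE_increases_to_def)
qed

theorem lemma7p6:
  fixes M :: "'a measure" and \<A> :: "'a set set"
  assumes "sigma_finite_measure M"
    and "full_ordered_core M \<A>"
  shows "(\<forall>g::'a \<Rightarrow> ereal. g \<in> borel_measurable M \<longrightarrow>
            (\<exists>k. least_core_dec_majorant M \<A> g k) \<and>
            (\<forall>k k'. least_core_dec_majorant M \<A> g k \<longrightarrow> least_core_dec_majorant M \<A> g k' \<longrightarrow>
               (AE x in M. k x = k' x))) \<and>
         (\<forall>(gs :: nat \<Rightarrow> 'a \<Rightarrow> ereal) g ks k.
            (\<forall>n. gs n \<in> nonneg_measurable M) \<longrightarrow> g \<in> borel_measurable M \<longrightarrow>
            AE_increases_to M gs g \<longrightarrow>
            (\<forall>n. least_core_dec_majorant M \<A> (gs n) (ks n)) \<longrightarrow>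
            least_core_dec_majorant M \<A> g k \<longrightarrow>
            AE_increases_to M ks k)"
proof (intro conjI allI impI)
  fix g :: "'a \<Rightarrow> ereal"
  show "\<exists>k. least_core_dec_majorant M \<A> g k"
    using assms by (rule exists_least_core_dec_majorant)
next
  fix g k k' :: "'a \<Rightarrow> ereal"
  assume "least_core_dec_majorant M \<A> g k" "least_core_dec_majorant M \<A> g k'"
  then show "AE x in M. k x = k' x"
    by (rule least_core_dec_majorant_AE_unique)
next
  fix gs ks :: "nat \<Rightarrow> 'a \<Rightarrow> ereal" and g k :: "'a \<Rightarrow> ereal"
  assume gs: "\<forall>n. gs n \<in> nonneg_measurable M" and incr: "AE_increases_to M gs g"
    and ks: "\<forall>n. least_core_dec_majorant M \<A> (gs n) (ks n)"
    and k: "least_core_dec_majorant M \<A> g k"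
  have "AE x in M. 0 \<le> gs n x" for n
    using gs by (simp add: nonneg_measurable_def)
  then show "AE_increases_to M ks k"
    using incr ks[rule_format] k by (rule least_core_dec_majorant_AE_increases_to)
qed

end
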